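(* Let $X,Y$ be Banach spaces, let $E:X\to Y$ be a bounded linear operator, let $A:X\supset\operatorname{dom}A\to Y$ be a closed, densely defined linear operator, and suppose there is $\mu\in\mathbb{C}$ such that $\mu E-A$ maps $\operatorname{dom}A$ bijectively onto $Y$. Let $\mathcal{A}(\lambda)=\lambda E-A$. Then for all $\lambda\in\mathbb{C}\cup\{\infty\}$ and all $k\ge1$, $$w_k(E|_{\operatorname{dom}A}^{-1}A;\lambda)=w_k(\mathcal{A};\lambda)=w_k(AE^{-1};\lambda).$$
   Context: All vector spaces are complex. A linear relation in a vector space $Z$ is a linear subspace $\mathcal{L}\subseteq Z\times Z$. Notation: $\mathcal{L}-\lambda=\{(x,y-\lambda x):(x,y)\in\mathcal{L}\}$; $\mathcal{L}^{-1}=\{(y,x):(x,y)\in\mathcal{L}\}$; $\mathcal{M}\mathcal{L}=\{(x,z):(x,y)\in\mathcal{L},(y,z)\in\mathcal{M}\text{ for some }y\}$; $\ker\mathcal{L}=\{x:(x,0)\in\mathcal{L}\}$; $\mathcal{L}^k$ is the $k$-fold product, $\mathcal{L}^0$ is the identity relation, $\mathcal{L}^{-k}=(\mathcal{L}^{-1})^k$. Root subspaces of a linear relation: for $k\ge0$, $\mathfrak{R}^k_\lambda(\mathcal{L})=\ker(\mathcal{L}-\lambda)^k$ for $\lambda\in\mathbb{C}$, and $\mathfrak{R}^k_\infty(\mathcal{L})=\ker\mathcal{L}^{-k}$. Weyr characteristic of a linear relation: $w_k(\mathcal{L};\lambda)=\dim\big(\mathfrak{R}^k_\lambda(\mathcal{L})/\mathfrak{R}^{k-1}_\lambda(\mathcal{L})\big)$,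 $k\ge1$, $\lambda\in\mathbb{C}\cup\{\infty\}$. Kernel representation of the pencil: $E|_{\operatorname{dom}A}^{-1}A=\{(x,z)\in\operatorname{dom}A\times\operatorname{dom}A: Ax=Ez\}$, a linear relation in $\operatorname{dom}A$. Range representation: $AE^{-1}=\{(Ey,Ay): y\in\operatorname{dom}A\}$, a linear relation in $Y$. Weyr characteristic of the pencil: $w_k(\mathcal{A};\lambda):=w_k(E|_{\operatorname{dom}A}^{-1}A;\lambda)$. This equals $\dim\big(\mathfrak{R}^k_\lambda(E,A)/\mathfrak{R}^{k-1}_\lambda(E,A)\big)$, where $\mathfrak{R}^0_\lambda(E,A)=\{0\}$ and, for $k\ge1$, $\mathfrak{R}^k_\lambda(E,A)$ is the set of last elements $x_k$ of Jordan chains $(x_1,\dots,x_k)\in(\operatorname{dom}A)^k$, that is, $(A-\lambda E)x_1=0$, $(A-\lambda E)x_j=Ex_{j-1}$ for $2\le j\le k$ if $\lambda\in\mathbb{C}$, and $Ex_1=0$, $Ex_j=Ax_{j-1}$ for $2\le j\le k$ if $\lambda=\infty$. *)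

theory Defs
  imports "HOL-Analysis.Analysis"
begin

unbundle cardinal_syntax

section \<open>Complex Banach spaces\<close>

class complex_vector = ab_group_add +
  fixes scaleC :: "complex \<Rightarrow> 'a \<Rightarrow> 'a"  (infixr "*\<^sub>C" 75)
  assumes scaleC_add_right: "a *\<^sub>C (x + y) = a *\<^sub>C x + a *\<^sub>C y"
    and scaleC_add_left: "(a + b) *\<^sub>C x = a *\<^sub>C x + b *\<^sub>C x"
    and scaleC_scaleC: "a *\<^sub>C (b *\<^sub>C x) = (a * b) *\<^sub>C x"
    and scaleC_one: "1 *\<^sub>C x = x"

class complex_normed_vector = complex_vector + real_normed_vector +
  assumes scaleR_scaleC: "r *\<^sub>R x = complex_of_real r *\<^sub>C x"
    and norm_scaleC: "norm (a *\<^sub>C x) = cmod a * norm x"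

class complex_banach = complex_normed_vector + complete_space

instantiation complex :: complex_banach
begin

definition scaleC_complex :: "complex \<Rightarrow> complex \<Rightarrow> complex"
  where "scaleC_complex a x = a * x"

instance
  by standard
    (simp_all add: scaleC_complex_def algebra_simps norm_mult scaleR_conv_of_real)

end

global_interpretation complex_vector:
  vector_space "scaleC :: complex \<Rightarrow> 'a \<Rightarrow> 'a::complex_vector"
  by standard (rule scaleC_add_right scaleC_add_left scaleC_scaleC scaleC_one)+


section \<open>Operators\<close>

definition bounded_clinear :: "('a::complex_normed_vector \<Rightarrow> 'b::complex_normed_vector) \<Rightarrow> bool"
  where "bounded_clinear T \<longleftrightarrow>
    Vector_Spaces.linear scaleC scaleC T \<and> (\<exists>K. \<forall>x. norm (T x) \<le> K * norm x)"

text \<open>A partially defined operator with domain \<open>D\<close> is a total function whose values outside \<open>D\<close>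
  are never used.\<close>

definition clinear_on :: "'a::complex_vector set \<Rightarrow> ('a \<Rightarrow> 'b::complex_vector) \<Rightarrow> bool"
  where "clinear_on D A \<longleftrightarrow> complex_vector.subspace D \<and>
    (\<forall>x\<in>D. \<forall>y\<in>D. A (x + y) = A x + A y) \<and>
    (\<forall>c. \<forall>x\<in>D. A (c *\<^sub>C x) = c *\<^sub>C A x)"

definition closed_operator_on ::
    "'a::complex_normed_vector set \<Rightarrow> ('a \<Rightarrow> 'b::complex_normed_vector) \<Rightarrow> bool"
  where "closed_operator_on D A \<longleftrightarrow> closed {(x, A x) | x. x \<in> D}"

definition densely_defined :: "'a::complex_normed_vector set \<Rightarrow> bool"
  where "densely_defined D \<longleftrightarrow> closure D = UNIV"


section \<open>Dimension of a quotient space\<close>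

text \<open>The elements of \<open>V / U\<close> are the cosets \<open>x +o U\<close>. The sum of cosets is their Minkowski sum;
  \<open>c\<close> times a coset is its elementwise multiple, except that for \<open>c = 0\<close> the latter is \<open>{0}\<close>
  instead of \<open>U\<close>, which the summand \<open>U\<close> (the zero of \<open>V / U\<close>) in \<open>quotient_lincomb\<close> repairs;
  see the lemma below.\<close>

definition quotient_space :: "'a::complex_vector set \<Rightarrow> 'a set \<Rightarrow> 'a set set"
  where "quotient_space V U = (\<lambda>x. x +o U) ` V"

definition quotient_lincomb ::
    "'a::complex_vector set \<Rightarrow> ('a set \<Rightarrow> complex) \<Rightarrow> 'a set set \<Rightarrow> 'a set"
  where "quotient_lincomb U c F = U + (\<Sum>Q\<in>F. (\<lambda>x. c Q *\<^sub>C x) ` Q)"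

lemma quotient_lincomb_representatives:
  assumes U: "complex_vector.subspace U" and "finite F" and "\<And>Q. Q \<in> F \<Longrightarrow> Q = r Q +o U"
  shows "quotient_lincomb U c F = (\<Sum>Q\<in>F. c Q *\<^sub>C r Q) +o U"
  using assms(2,3)
proof (induction F)
  case empty
  then show ?case
    by (simp add: quotient_lincomb_def set_plus_def elt_set_plus_def)
next
  case (insert Q F)
  let ?s = "\<Sum>Q\<in>F. c Q *\<^sub>C r Q"
  have step: "(\<lambda>x. c Q *\<^sub>C x) ` Q + (?s +o U) = (c Q *\<^sub>C r Q + ?s) +o U"
  proof (intro set_eqI iffI)
    fix z
    assume "z \<in> (\<lambda>x. c Q *\<^sub>C x) ` Q + (?s +o U)"
    then obtain x v where x: "x \<in> Q" and v: "v \<in> U" and z: "z = c Q *\<^sub>C x + (?s + v)"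
      by (auto simp: set_plus_def elt_set_plus_def)
    obtain u where u: "u \<in> U" and xu: "x = r Q + u"
      using x insert.prems[of Q] by (auto simp: elt_set_plus_def)
    have "z = (c Q *\<^sub>C r Q + ?s) + (c Q *\<^sub>C u + v)"
      by (simp add: z xu scaleC_add_right algebra_simps)
    moreover have "c Q *\<^sub>C u + v \<in> U"
      using U u v by (simp add: complex_vector.subspace_add complex_vector.subspace_scale)
    ultimately show "z \<in> (c Q *\<^sub>C r Q + ?s) +o U"
      by (auto simp: elt_set_plus_def)
  next
    fix z
    assume "z \<in> (c Q *\<^sub>C r Q + ?s) +o U"
    then obtain v where v: "v \<in> U" and z: "z = c Q *\<^sub>C r Q + (?s + v)"
      by (auto simp: elt_set_plus_def algebra_simps)
    have "r Q + 0 \<in> Q"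
      using complex_vector.subspace_0[OF U] insert.prems[of Q] by (auto simp: elt_set_plus_def)
    then show "z \<in> (\<lambda>x. c Q *\<^sub>C x) ` Q + (?s +o U)"
      using v z by (auto simp: set_plus_def elt_set_plus_def)
  qed
  have "quotient_lincomb U c (insert Q F) = (\<lambda>x. c Q *\<^sub>C x) ` Q + quotient_lincomb U c F"
    using insert.hyps by (simp add: quotient_lincomb_def add.left_commute)
  also have "\<dots> = (c Q *\<^sub>C r Q + ?s) +o U"
    using insert.IH insert.prems step by simp
  finally show ?case
    using insert.hyps by simp
qed

definition quotient_basis :: "'a::complex_vector set \<Rightarrow> 'a set \<Rightarrow> 'a set set \<Rightarrow> bool"
  where "quotient_basis V U B \<longleftrightarrow>
    B \<subseteq> quotient_space V U \<and>
    (\<forall>F c. finite F \<and> F \<subseteq> B \<and> quotient_lincomb U c F = U \<longrightarrow> (\<forall>Q\<in>F. c Q = 0)) \<and>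
    (\<forall>P\<in>quotient_space V U. \<exists>F c. finite F \<and> F \<subseteq> B \<and> P = quotient_lincomb U c F)"

text \<open>Dimensions are cardinals, also in the infinite-dimensional case; they are compared by \<open>=o\<close>,
  which makes sense across different types.\<close>

definition quotient_dim :: "'a::complex_vector set \<Rightarrow> 'a set \<Rightarrow> 'a set rel"
  where "quotient_dim V U = |SOME B. quotient_basis V U B|"


section \<open>Linear relations\<close>

text \<open>Linear relations in a space \<open>Z\<close> are sets of pairs, with \<open>Z\<close> a subset of a type. The product
  \<open>M L\<close> (first \<open>L\<close>, then \<open>M\<close>) is the relational composition \<open>L O M\<close> of the library. The space
  \<open>Z\<close> matters only for the zeroth power.\<close>

definition linear_relation :: "'a::complex_vector set \<Rightarrow> 'a rel \<Rightarrow> bool"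
  where "linear_relation Z L \<longleftrightarrow> complex_vector.subspace Z \<and> L \<subseteq> Z \<times> Z \<and> (0, 0) \<in> L \<and>
    (\<forall>(x, y)\<in>L. \<forall>(x', y')\<in>L. (x + x', y + y') \<in> L) \<and>
    (\<forall>c. \<forall>(x, y)\<in>L. (c *\<^sub>C x, c *\<^sub>C y) \<in> L)"

datatype ext_complex = Fin complex | Infty

definition relation_shift :: "'a::complex_vector rel \<Rightarrow> complex \<Rightarrow> 'a rel"
  where "relation_shift L \<zeta> = {(x, y - \<zeta> *\<^sub>C x) | x y. (x, y) \<in> L}"

primrec relation_power :: "'a set \<Rightarrow> 'a rel \<Rightarrow> nat \<Rightarrow> 'a rel"
  where
    "relation_power Z L 0 = Id_on Z"
  | "relation_power Z L (Suc k) = L O relation_power Z L k"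

definition relation_ker :: "'a::complex_vector rel \<Rightarrow> 'a set"
  where "relation_ker L = {x. (x, 0) \<in> L}"

primrec root_subspace :: "'a::complex_vector set \<Rightarrow> 'a rel \<Rightarrow> ext_complex \<Rightarrow> nat \<Rightarrow> 'a set"
  where
    "root_subspace Z L (Fin \<zeta>) = (\<lambda>k. relation_ker (relation_power Z (relation_shift L \<zeta>) k))"
  | "root_subspace Z L Infty = (\<lambda>k. relation_ker (relation_power Z (L\<inverse>) k))"

definition weyr :: "'a::complex_vector set \<Rightarrow> 'a rel \<Rightarrow> nat \<Rightarrow> ext_complex \<Rightarrow> 'a set rel"
  where "weyr Z L k \<zeta> = quotient_dim (root_subspace Z L \<zeta> k) (root_subspace Z L \<zeta> (k - 1))"


section \<open>The pencil \<open>\<zeta>E - A\<close> with \<open>A\<close> defined on \<open>D\<close>\<close>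

definition kernel_rep ::
    "('a::complex_vector \<Rightarrow> 'b::complex_vector) \<Rightarrow> 'a set \<Rightarrow> ('a \<Rightarrow> 'b) \<Rightarrow> 'a rel"
  where "kernel_rep E D A = {(x, z). x \<in> D \<and> z \<in> D \<and> A x = E z}"

definition range_rep ::
    "('a::complex_vector \<Rightarrow> 'b::complex_vector) \<Rightarrow> 'a set \<Rightarrow> ('a \<Rightarrow> 'b) \<Rightarrow> 'b rel"
  where "range_rep E D A = {(E y, A y) | y. y \<in> D}"

definition pencil_weyr ::
    "('a::complex_vector \<Rightarrow> 'b::complex_vector) \<Rightarrow> 'a set \<Rightarrow> ('a \<Rightarrow> 'b) \<Rightarrow> nat
      \<Rightarrow> ext_complex \<Rightarrow> 'a set rel"
  where "pencil_weyr E D A k \<zeta> = weyr D (kernel_rep E D A) k \<zeta>"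

lemma linear_relation_kernel_rep:
  assumes E: "Vector_Spaces.linear scaleC scaleC E" and A: "clinear_on D A"
  shows "linear_relation D (kernel_rep E D A)"
proof -
  interpret E: Vector_Spaces.linear scaleC scaleC E by (rule E)
  have D: "complex_vector.subspace D" using A by (simp add: clinear_on_def)
  have "A (0 *\<^sub>C 0) = 0 *\<^sub>C A 0"
    using A complex_vector.subspace_0[OF D] by (simp only: clinear_on_def)
  then have "A 0 = 0" by simp
  then show ?thesis
    using A D by (auto simp: linear_relation_def kernel_rep_def clinear_on_def E.add E.scale E.zero
        complex_vector.subspace_0 complex_vector.subspace_add complex_vector.subspace_scale)
qed

lemma linear_relation_range_rep:
  assumes E: "Vector_Spaces.linear scaleC scaleC E" and A: "clinear_on D A"
  shows "linear_relation UNIV (range_rep E D A)"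
proof -
  interpret E: Vector_Spaces.linear scaleC scaleC E by (rule E)
  have D: "complex_vector.subspace D" using A by (simp add: clinear_on_def)
  have "A (0 *\<^sub>C 0) = 0 *\<^sub>C A 0"
    using A complex_vector.subspace_0[OF D] by (simp only: clinear_on_def)
  then have A0: "A 0 = 0" by simp
  have 1: "(0, 0) \<in> range_rep E D A"
    unfolding range_rep_def using A0 E.zero complex_vector.subspace_0[OF D] by force
  have 2: "(E x + E y, A x + A y) \<in> range_rep E D A" if "x \<in> D" "y \<in> D" for x y
    unfolding range_rep_def mem_Collect_eq using that A D
    by (intro exI[of _ "x + y"]) (simp add: clinear_on_def E.add complex_vector.subspace_add)
  have 3: "(c *\<^sub>C E x, c *\<^sub>C A x) \<in> range_rep E D A" if "x \<in> D" for c x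
    unfolding range_rep_def mem_Collect_eq using that A D
    by (intro exI[of _ "c *\<^sub>C x"]) (simp add: clinear_on_def E.scale complex_vector.subspace_scale)
  have 4: "\<exists>y\<in>D. p = (E y, A y)" if "p \<in> range_rep E D A" for p
    using that by (auto simp: range_rep_def)
  show ?thesis
    unfolding linear_relation_def using 1 2 3 by (fastforce dest!: 4)
qed

text \<open>The root subspaces of the pencil in terms of Jordan chains, and their agreement with the
  root subspaces used in \<open>pencil_weyr\<close>.\<close>

fun jordan_step ::
    "('a::complex_vector \<Rightarrow> 'b::complex_vector) \<Rightarrow> ('a \<Rightarrow> 'b) \<Rightarrow> ext_complex \<Rightarrow> 'a \<Rightarrow> 'a \<Rightarrow> bool"
  where
    "jordan_step E A (Fin \<zeta>) x' x \<longleftrightarrow> A x - \<zeta> *\<^sub>C E x = E x'"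
  | "jordan_step E A Infty x' x \<longleftrightarrow> E x = A x'"

fun jordan_start ::
    "('a::complex_vector \<Rightarrow> 'b::complex_vector) \<Rightarrow> ('a \<Rightarrow> 'b) \<Rightarrow> ext_complex \<Rightarrow> 'a \<Rightarrow> bool"
  where
    "jordan_start E A (Fin \<zeta>) x \<longleftrightarrow> A x - \<zeta> *\<^sub>C E x = 0"
  | "jordan_start E A Infty x \<longleftrightarrow> E x = 0"

definition jordan_root_subspace ::
    "('a::complex_vector \<Rightarrow> 'b::complex_vector) \<Rightarrow> 'a set \<Rightarrow> ('a \<Rightarrow> 'b) \<Rightarrow> ext_complex
      \<Rightarrow> nat \<Rightarrow> 'a set"
  where "jordan_root_subspace E D A \<zeta> k =
    (if k = 0 then {0} else
      {x k | x. (\<forall>j\<in>{1..k}. x j \<in> D) \<and> jordan_start E A \<zeta> (x 1) \<and>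
        (\<forall>j\<in>{2..k}. jordan_step E A \<zeta> (x (j - 1)) (x j))})"

lemma root_subspace_kernel_rep:
  assumes E: "Vector_Spaces.linear scaleC scaleC E" and A: "clinear_on D A"
  shows "root_subspace D (kernel_rep E D A) \<zeta> k = jordan_root_subspace E D A \<zeta> k"
proof -
  interpret E: Vector_Spaces.linear scaleC scaleC E by (rule E)
  have D: "complex_vector.subspace D" using A by (simp add: clinear_on_def)
  have D0: "0 \<in> D" by (rule complex_vector.subspace_0[OF D])
  have "A (0 *\<^sub>C 0) = 0 *\<^sub>C A 0"
    using A D0 by (simp only: clinear_on_def)
  then have A0: "A 0 = 0" by simp
  have start: "jordan_start E A \<zeta> x \<longleftrightarrow> jordan_step E A \<zeta> 0 x" for x
    by (cases \<zeta>) (simp_all add: A0 E.zero)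
  have root0: "root_subspace D (kernel_rep E D A) \<zeta> 0 = {0}"
    using D0 by (cases \<zeta>) (auto simp: relation_ker_def)
  have shift: "(x, z) \<in> relation_shift (kernel_rep E D A) \<mu> \<longleftrightarrow>
      x \<in> D \<and> z \<in> D \<and> A x - \<mu> *\<^sub>C E x = E z" for x z \<mu>
  proof
    assume "(x, z) \<in> relation_shift (kernel_rep E D A) \<mu>"
    then show "x \<in> D \<and> z \<in> D \<and> A x - \<mu> *\<^sub>C E x = E z"
      using D by (auto simp: relation_shift_def kernel_rep_def E.diff E.scale
          complex_vector.subspace_diff complex_vector.subspace_scale)
  next
    assume *: "x \<in> D \<and> z \<in> D \<and> A x - \<mu> *\<^sub>C E x = E z"
    have "(x, z + \<mu> *\<^sub>C x) \<in> kernel_rep E D A"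
      using * D by (auto simp: kernel_rep_def E.add E.scale algebra_simps
          complex_vector.subspace_add complex_vector.subspace_scale)
    then show "(x, z) \<in> relation_shift (kernel_rep E D A) \<mu>"
      unfolding relation_shift_def by force
  qed
  have rootS: "x \<in> root_subspace D (kernel_rep E D A) \<zeta> (Suc n) \<longleftrightarrow>
      x \<in> D \<and> (\<exists>x'\<in>D. jordan_step E A \<zeta> x' x \<and>
        x' \<in> root_subspace D (kernel_rep E D A) \<zeta> n)" for x n
  proof (cases \<zeta>)
    case (Fin \<mu>)
    then show ?thesis by (auto simp: relation_ker_def relcomp_unfold shift)
  next
    case Infty
    have "(x, z) \<in> (kernel_rep E D A)\<inverse> \<longleftrightarrow> x \<in> D \<and> z \<in> D \<and> E x = A z" for x z
      by (auto simp: kernel_rep_def)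
    with Infty show ?thesis by (auto simp: relation_ker_def relcomp_unfold)
  qed
  have chain: "y \<in> root_subspace D (kernel_rep E D A) \<zeta> n \<longleftrightarrow>
      (\<exists>x. x 0 = 0 \<and> x n = y \<and>
        (\<forall>j\<in>{1..n}. x j \<in> D \<and> jordan_step E A \<zeta> (x (j - 1)) (x j)))" for y n
  proof (induction n arbitrary: y)
    case 0
    show ?case by (auto simp: root0)
  next
    case (Suc n)
    show ?case
    proof
      assume "y \<in> root_subspace D (kernel_rep E D A) \<zeta> (Suc n)"
      then obtain x' where y: "y \<in> D" "jordan_step E A \<zeta> x' y"
        and "x' \<in> root_subspace D (kernel_rep E D A) \<zeta> n"
        by (auto simp: rootS)
      then obtain x where x: "x 0 = 0" "x n = x'"
        "\<forall>j\<in>{1..n}. x j \<in> D \<and> jordan_step E A \<zeta> (x (j - 1)) (x j)"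
        by (auto simp: Suc.IH)
      show "\<exists>x. x 0 = 0 \<and> x (Suc n) = y \<and>
          (\<forall>j\<in>{1..Suc n}. x j \<in> D \<and> jordan_step E A \<zeta> (x (j - 1)) (x j))"
        using x y by (intro exI[of _ "x(Suc n := y)"]) (auto simp: le_Suc_eq)
    next
      assume "\<exists>x. x 0 = 0 \<and> x (Suc n) = y \<and>
          (\<forall>j\<in>{1..Suc n}. x j \<in> D \<and> jordan_step E A \<zeta> (x (j - 1)) (x j))"
      then obtain x where x: "x 0 = 0" "x (Suc n) = y"
        and st: "\<And>j. 1 \<le> j \<Longrightarrow> j \<le> Suc n \<Longrightarrow>
          x j \<in> D \<and> jordan_step E A \<zeta> (x (j - 1)) (x j)"
        by auto
      have "x n \<in> root_subspace D (kernel_rep E D A) \<zeta> n"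
        unfolding Suc.IH using x st by (intro exI[of _ x]) auto
      moreover have "x n \<in> D"
        using x(1) D0 st[of n] by (cases n) auto
      ultimately show "y \<in> root_subspace D (kernel_rep E D A) \<zeta> (Suc n)"
        using st[of "Suc n"] x(2) by (auto simp: rootS)
    qed
  qed
  show ?thesis
  proof (cases "k = 0")
    case True
    then show ?thesis by (simp add: root0 jordan_root_subspace_def)
  next
    case False
    show ?thesis
    proof (intro set_eqI iffI)
      fix y
      assume "y \<in> root_subspace D (kernel_rep E D A) \<zeta> k"
      then obtain x where x: "x 0 = 0" "x k = y"
        "\<forall>j\<in>{1..k}. x j \<in> D \<and> jordan_step E A \<zeta> (x (j - 1)) (x j)"
        unfolding chain by blast
      have "jordan_start E A \<zeta> (x 1)"
        using bspec[OF x(3), of 1] x(1) False by (simp add: start)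
      then show "y \<in> jordan_root_subspace E D A \<zeta> k"
        using x False by (auto simp: jordan_root_subspace_def)
    next
      fix y
      assume "y \<in> jordan_root_subspace E D A \<zeta> k"
      then obtain x where x: "x k = y" "\<forall>j\<in>{1..k}. x j \<in> D" "jordan_start E A \<zeta> (x 1)"
        "\<forall>j\<in>{2..k}. jordan_step E A \<zeta> (x (j - 1)) (x j)"
        using False by (auto simp: jordan_root_subspace_def)
      have "jordan_step E A \<zeta> ((x(0 := 0)) (j - 1)) ((x(0 := 0)) j)" if "j \<in> {1..k}" for j
      proof (cases "j = 1")
        case True
        then show ?thesis using x(3) by (simp add: start)
      next
        case False
        then show ?thesis using x(4) that by auto
      qed
      then show "y \<in> root_subspace D (kernel_rep E D A) \<zeta> k"
        unfolding chain using x False by (intro exI[of _ "x(0 := 0)"]) auto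
    qed
  qed
qed

end

theory Submission
  imports Defs
begin

text \<open>
  For every \<open>\<zeta>\<close>, finite or infinite, a root subspace of either representation consists of the ends
  of chains \<open>P x\<^sub>j = Q x\<^sub>j\<^sub>-\<^sub>1\<close>, \<open>x\<^sub>0 = 0\<close>, for one pair of operators on \<open>D\<close>: \<open>P = A - \<zeta>E\<close>, \<open>Q = E\<close> if
  \<open>\<zeta>\<close> is finite and \<open>P = E\<close>, \<open>Q = A\<close> if \<open>\<zeta> = \<infinity>\<close>. Let \<open>K\<^sub>n\<close> (\<open>chain_kernel\<close>) be the set of ends \<open>x\<^sub>n\<close>;
  it is the root subspace of the kernel representation. The range representation relates \<open>Q x\<^sub>j\<close> to
  \<open>P x\<^sub>j = Q x\<^sub>j\<^sub>-\<^sub>1\<close>, so its root subspace is \<open>Q K\<^sub>n\<close> (\<open>range_chain_kernel\<close>). Hence \<open>Q\<close> induces a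
  surjection from \<open>K\<^sub>n\<^sub>+\<^sub>1 / K\<^sub>n\<close> onto the corresponding quotient of the range representation, and it
  remains to see that this map is injective, that is, that
  \<open>ker Q \<inter> K\<^sub>n\<^sub>+\<^sub>1 \<subseteq> K\<^sub>n\<close> (\<open>chain_kernel_inter_kernel\<close>).

  Here the bijectivity of \<open>\<mu>E - A\<close> enters. In both cases it is a combination \<open>W = aP + bQ\<close>. The
  operators \<open>W\<^sup>-\<^sup>1P\<close> and \<open>W\<^sup>-\<^sup>1Q\<close> on \<open>D\<close> commute, because \<open>a W\<^sup>-\<^sup>1P + b W\<^sup>-\<^sup>1Q = 1\<close>, so \<open>W\<^sup>-\<^sup>1Q\<close> maps
  chains to chains (\<open>chain_kernel_resolvent_invariant\<close>). If \<open>x \<in> K\<^sub>n\<^sub>+\<^sub>1\<close>, say \<open>P x = Q x'\<close> with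
  \<open>x' \<in> K\<^sub>n\<close>, and \<open>Q x = 0\<close>, then \<open>W x = a P x = a Q x'\<close>, so that \<open>x = a W\<^sup>-\<^sup>1Q x'\<close> lies in \<open>K\<^sub>n\<close>.

  Dimensions of quotients are cardinals of bases made of cosets. To compare them, a quotient
  \<open>V / U\<close> is replaced by the image \<open>h V\<close> under a linear map \<open>h\<close> with kernel \<open>U\<close> on \<open>V\<close>, where any
  two bases have the same cardinality (\<open>quotient_dim_eq_card_image_basis\<close>). Two quotients whose
  images coincide thus have the same dimension.
\<close>

section \<open>Partially defined linear maps\<close>

lemma clinear_on_subspace: "clinear_on D A \<Longrightarrow> complex_vector.subspace D"
  by (simp add: clinear_on_def)

lemma clinear_on_add: "clinear_on D A \<Longrightarrow> x \<in> D \<Longrightarrow> y \<in> D \<Longrightarrow> A (x + y) = A x + A y"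
  by (simp add: clinear_on_def)

lemma clinear_on_scale: "clinear_on D A \<Longrightarrow> x \<in> D \<Longrightarrow> A (c *\<^sub>C x) = c *\<^sub>C A x"
  by (simp add: clinear_on_def)

lemma clinear_on_0: "clinear_on D A \<Longrightarrow> A 0 = 0"
  by (metis clinear_on_scale clinear_on_subspace complex_vector.subspace_0
      complex_vector.scale_zero_left)

lemma clinear_on_diff:
  assumes "clinear_on D A" "x \<in> D" "y \<in> D"
  shows "A (x - y) = A x - A y"
proof -
  have "x - y \<in> D"
    using assms by (simp add: clinear_on_subspace complex_vector.subspace_diff)
  then show ?thesis
    using clinear_on_add[of D A "x - y" y] assms by simp
qed

lemma clinear_on_sum:
  assumes "clinear_on D A" "\<And>i. i \<in> F \<Longrightarrow> x i \<in> D"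
  shows "A (\<Sum>i\<in>F. x i) = (\<Sum>i\<in>F. A (x i))"
  using assms(2)
proof (induction F rule: infinite_finite_induct)
  case (insert i F)
  have "(\<Sum>i\<in>F. x i) \<in> D"
    using assms(1) insert.prems by (intro complex_vector.subspace_sum clinear_on_subspace) auto
  then show ?case
    using insert clinear_on_add[OF assms(1)] by simp
qed (simp_all add: clinear_on_0[OF assms(1)])

lemma clinear_on_mono:
  "clinear_on D A \<Longrightarrow> complex_vector.subspace V \<Longrightarrow> V \<subseteq> D \<Longrightarrow> clinear_on V A"
  unfolding clinear_on_def by (meson subsetD)

lemma clinear_on_image_subspace:
  assumes "clinear_on V A"
  shows "complex_vector.subspace (A ` V)"
proof (rule complex_vector.subspaceI)
  note V = clinear_on_subspace[OF assms]
  show "0 \<in> A ` V"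
    using clinear_on_0[OF assms] complex_vector.subspace_0[OF V] by force
  show "x + y \<in> A ` V" if xy: "x \<in> A ` V" "y \<in> A ` V" for x y
  proof -
    from xy obtain u v where "u \<in> V" "v \<in> V" "x = A u" "y = A v" by blast
    then show ?thesis
      using complex_vector.subspace_add[OF V] clinear_on_add[OF assms, of u v]
      by (intro image_eqI[of _ _ "u + v"]) simp_all
  qed
  show "c *\<^sub>C x \<in> A ` V" if x: "x \<in> A ` V" for c x
  proof -
    from x obtain u where "u \<in> V" "x = A u" by blast
    then show ?thesis
      using complex_vector.subspace_scale[OF V] clinear_on_scale[OF assms, of u c]
      by (intro image_eqI[of _ _ "c *\<^sub>C u"]) simp_all
  qed
qed

section \<open>Quotient dimension as the dimension of an image\<close>

text \<open>The isomorphism \<open>V / U \<rightarrow> h V\<close>: since \<open>h\<close> is constant on each coset of its kernel, the image of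
  a coset \<open>Q\<close> is a singleton and \<open>the_elem (h ` Q)\<close> needs no choice of a representative.\<close>

lemma coset_map_bij_betw:
  assumes h: "clinear_on V h" and U: "U = {x \<in> V. h x = 0}"
  shows "bij_betw (\<lambda>Q. the_elem (h ` Q)) (quotient_space V U) (h ` V)"
    and "\<And>x. x \<in> V \<Longrightarrow> the_elem (h ` (x +o U)) = h x"
proof -
  note V = clinear_on_subspace[OF h]
  have U0: "0 \<in> U"
    using U clinear_on_0[OF h] complex_vector.subspace_0[OF V] by simp
  show H: "the_elem (h ` (x +o U)) = h x" if "x \<in> V" for x
  proof -
    have "h y = h x" if y: "y \<in> x +o U" for y
    proof -
      obtain u where u: "u \<in> U" "y = x + u"
        using y by (auto simp: elt_set_plus_def)
      then have "u \<in> V" "h u = 0" by (simp_all add: U)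
      then show ?thesis
        using clinear_on_add[OF h \<open>x \<in> V\<close>] u(2) by simp
    qed
    moreover have "x +o U \<noteq> {}"
      using set_plus_intro2[OF U0] by blast
    ultimately have "h ` (x +o U) = {h x}"
      by (simp add: image_constant_conv cong: image_cong)
    then show ?thesis by simp
  qed
  have "x +o U \<subseteq> y +o U" if "x \<in> V" "y \<in> V" "h x = h y" for x y
  proof
    fix z assume "z \<in> x +o U"
    then obtain u where u: "u \<in> U" "z = x + u"
      by (auto simp: elt_set_plus_def)
    \<comment> \<open>Move the base point from \<open>x\<close> to \<open>y\<close>: the difference \<open>x - y\<close> lies in the kernel.\<close>
    then have z: "z = y + ((x - y) + u)" by simp
    have "u \<in> V" "h u = 0" "x - y \<in> V"
      using u(1) that complex_vector.subspace_diff[OF V] by (simp_all add: U)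
    then have "(x - y) + u \<in> U"
      using that(3) complex_vector.subspace_add[OF V] clinear_on_add[OF h, of "x - y" u]
        clinear_on_diff[OF h that(1,2)]
      by (simp add: U)
    then have "y + ((x - y) + u) \<in> y +o U" by (rule set_plus_intro2)
    then show "z \<in> y +o U" by (simp only: z)
  qed
  then have coset_eq: "x +o U = y +o U" if "x \<in> V" "y \<in> V" "h x = h y" for x y
    using that by (intro subset_antisym) simp_all
  have "inj_on (\<lambda>Q. the_elem (h ` Q)) (quotient_space V U)"
  proof (rule inj_onI)
    fix P Q
    assume "P \<in> quotient_space V U" "Q \<in> quotient_space V U" "the_elem (h ` P) = the_elem (h ` Q)"
    then obtain x y where "x \<in> V" "y \<in> V" and PQ: "P = x +o U" "Q = y +o U"
        and "the_elem (h ` P) = the_elem (h ` Q)"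
      unfolding quotient_space_def by blast
    then have "h x = h y" by (simp add: H)
    then show "P = Q"
      unfolding PQ by (rule coset_eq[OF \<open>x \<in> V\<close> \<open>y \<in> V\<close>])
  qed
  moreover have "(\<lambda>Q. the_elem (h ` Q)) ` quotient_space V U = h ` V"
    by (simp add: quotient_space_def image_image H cong: image_cong)
  ultimately show "bij_betw (\<lambda>Q. the_elem (h ` Q)) (quotient_space V U) (h ` V)"
    by (simp add: bij_betw_def)
qed

text \<open>Linearity of the isomorphism, for the linear combinations of cosets that define bases of a
  quotient.\<close>

lemma coset_map_quotient_lincomb:
  assumes h: "clinear_on V h" and U: "U = {x \<in> V. h x = 0}"
    and F: "finite F" "F \<subseteq> quotient_space V U"
  shows "quotient_lincomb U c F \<in> quotient_space V U"
    and "the_elem (h ` quotient_lincomb U c F) = (\<Sum>Q\<in>F. c Q *\<^sub>C the_elem (h ` Q))"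
proof -
  note V = clinear_on_subspace[OF h]
  have subU: "complex_vector.subspace U"
    unfolding U using V clinear_on_0[OF h]
    by (auto intro!: complex_vector.subspaceI simp: clinear_on_add[OF h] clinear_on_scale[OF h]
        complex_vector.subspace_0 complex_vector.subspace_add complex_vector.subspace_scale)
  have "\<forall>Q\<in>F. \<exists>x\<in>V. Q = x +o U"
    using F(2) by (auto simp: quotient_space_def)
  then obtain r where r: "\<And>Q. Q \<in> F \<Longrightarrow> r Q \<in> V" "\<And>Q. Q \<in> F \<Longrightarrow> Q = r Q +o U"
    by metis
  have eq: "quotient_lincomb U c F = (\<Sum>Q\<in>F. c Q *\<^sub>C r Q) +o U"
    by (rule quotient_lincomb_representatives[OF subU F(1) r(2)])
  have inV: "(\<Sum>Q\<in>F. c Q *\<^sub>C r Q) \<in> V"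
    using r(1) V by (intro complex_vector.subspace_sum complex_vector.subspace_scale) auto
  show "quotient_lincomb U c F \<in> quotient_space V U"
    using eq inV by (auto simp: quotient_space_def)
  have "the_elem (h ` Q) = h (r Q)" if "Q \<in> F" for Q
    using coset_map_bij_betw(2)[OF h U r(1)[OF that]] r(2)[OF that] by simp
  moreover have "h (\<Sum>Q\<in>F. c Q *\<^sub>C r Q) = (\<Sum>Q\<in>F. c Q *\<^sub>C h (r Q))"
    using r(1) V by (subst clinear_on_sum[OF h])
      (auto intro!: sum.cong simp: clinear_on_scale[OF h] complex_vector.subspace_scale)
  ultimately show "the_elem (h ` quotient_lincomb U c F) = (\<Sum>Q\<in>F. c Q *\<^sub>C the_elem (h ` Q))"
    by (simp add: eq coset_map_bij_betw(2)[OF h U inV])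
qed

text \<open>An isomorphism carries bases to bases in both directions. This turns the coset notion of
  basis into the one for vectors, for which existence and equal cardinality are known.\<close>

lemma quotient_basis_iff_image_basis:
  assumes h: "clinear_on V h" and U: "U = {x \<in> V. h x = 0}"
    and B: "B \<subseteq> quotient_space V U"
  shows "quotient_basis V U B \<longleftrightarrow>
    complex_vector.independent ((\<lambda>Q. the_elem (h ` Q)) ` B) \<and>
    complex_vector.span ((\<lambda>Q. the_elem (h ` Q)) ` B) = h ` V"
proof -
  define H where "H = (\<lambda>Q. the_elem (h ` Q))"
  note V = clinear_on_subspace[OF h]
  have bij: "bij_betw H (quotient_space V U) (h ` V)"
    unfolding H_def by (rule coset_map_bij_betw(1)[OF h U])
  have lin: "quotient_lincomb U c F \<in> quotient_space V U"
      "H (quotient_lincomb U c F) = (\<Sum>Q\<in>F. c Q *\<^sub>C H Q)" if "finite F" "F \<subseteq> B" for F c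
    using coset_map_quotient_lincomb[OF h U that(1)] that B unfolding H_def by auto
  have inj: "inj_on H F" if "F \<subseteq> B" for F
    using bij that B by (meson bij_betw_def inj_on_subset order_trans)
  have eqI: "P = Q \<longleftrightarrow> H P = H Q" if "P \<in> quotient_space V U" "Q \<in> quotient_space V U" for P Q
    using bij that by (metis bij_betw_def inj_on_eq_iff)
  have Uq: "U \<in> quotient_space V U" and HU: "H U = 0"
  proof -
    have U_coset: "0 +o U = U" by (simp add: elt_set_plus_def)
    show "U \<in> quotient_space V U"
      using U_coset complex_vector.subspace_0[OF V] unfolding quotient_space_def by force
    show "H U = 0"
      using coset_map_bij_betw(2)[OF h U complex_vector.subspace_0[OF V]] clinear_on_0[OF h]
      by (simp add: U_coset H_def)
  qed
  have zero: "quotient_lincomb U c F = U \<longleftrightarrow> (\<Sum>Q\<in>F. c Q *\<^sub>C H Q) = 0"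
    if "finite F" "F \<subseteq> B" for F c
    using eqI[OF lin(1)[OF that] Uq] lin(2)[OF that] HU by simp
  have independent: "(\<forall>F c. finite F \<and> F \<subseteq> B \<and> quotient_lincomb U c F = U \<longrightarrow> (\<forall>Q\<in>F. c Q = 0))
      \<longleftrightarrow> complex_vector.independent (H ` B)" (is "?L \<longleftrightarrow> ?R")
  proof
    assume L: ?L
    show ?R
      unfolding complex_vector.independent_explicit_module
    proof (intro allI impI)
      fix T u v
      assume T: "finite T" "T \<subseteq> H ` B" "(\<Sum>v\<in>T. u v *\<^sub>C v) = 0" "v \<in> T"
      obtain F where F: "F \<subseteq> B" "finite F" "T = H ` F"
        using T(1,2) by (meson finite_subset_image)
      have "(\<Sum>Q\<in>F. u (H Q) *\<^sub>C H Q) = 0"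
        using T(3) by (simp add: F(3) sum.reindex[OF inj[OF F(1)]])
      then have "\<forall>Q\<in>F. u (H Q) = 0"
        using L zero[OF F(2,1), of "\<lambda>Q. u (H Q)"] F by blast
      then show "u v = 0" using T(4) F(3) by auto
    qed
  next
    assume R: ?R
    show ?L
    proof (intro allI impI ballI)
      fix F c Q
      assume "finite F \<and> F \<subseteq> B \<and> quotient_lincomb U c F = U" and Q: "Q \<in> F"
      then have F: "finite F" "F \<subseteq> B" and s: "(\<Sum>Q\<in>F. c Q *\<^sub>C H Q) = 0"
        using zero by auto
      \<comment> \<open>The coefficients live on cosets; transport them to vectors along the inverse of \<open>H\<close>.\<close>
      have "(\<Sum>v\<in>H ` F. c (the_inv_into F H v) *\<^sub>C v) = (\<Sum>Q\<in>F. c Q *\<^sub>C H Q)"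
        by (simp add: sum.reindex[OF inj[OF F(2)]] the_inv_into_f_f[OF inj[OF F(2)]])
      then have "c (the_inv_into F H (H Q)) = 0"
        using R[unfolded complex_vector.independent_explicit_module, rule_format,
            of "H ` F" "\<lambda>v. c (the_inv_into F H v)" "H Q"] F s Q by auto
      then show "c Q = 0" by (simp add: the_inv_into_f_f[OF inj[OF F(2)] Q])
    qed
  qed
  have span: "complex_vector.span (H ` B) =
      {\<Sum>Q\<in>F. c Q *\<^sub>C H Q | F c. finite F \<and> F \<subseteq> B}"
  proof (intro set_eqI iffI)
    fix y
    assume "y \<in> complex_vector.span (H ` B)"
    then obtain T u where T: "finite T" "T \<subseteq> H ` B" "y = (\<Sum>v\<in>T. u v *\<^sub>C v)"
      by (auto simp: complex_vector.span_explicit)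
    obtain F where F: "F \<subseteq> B" "finite F" "T = H ` F"
      using T(1,2) by (meson finite_subset_image)
    have "y = (\<Sum>Q\<in>F. u (H Q) *\<^sub>C H Q)"
      using T(3) by (simp add: F(3) sum.reindex[OF inj[OF F(1)]])
    then show "y \<in> {\<Sum>Q\<in>F. c Q *\<^sub>C H Q | F c. finite F \<and> F \<subseteq> B}"
      using F by (intro CollectI exI[of _ F] exI[of _ "\<lambda>Q. u (H Q)"]) simp
  next
    fix y
    assume "y \<in> {\<Sum>Q\<in>F. c Q *\<^sub>C H Q | F c. finite F \<and> F \<subseteq> B}"
    then obtain F c where "F \<subseteq> B" "y = (\<Sum>Q\<in>F. c Q *\<^sub>C H Q)"
      by blast
    then show "y \<in> complex_vector.span (H ` B)"
      by (simp add: complex_vector.span_sum complex_vector.span_scale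
          complex_vector.span_base subset_iff)
  qed
  have spanning: "(\<forall>P\<in>quotient_space V U. \<exists>F c. finite F \<and> F \<subseteq> B \<and> P = quotient_lincomb U c F)
      \<longleftrightarrow> complex_vector.span (H ` B) = h ` V"
  proof -
    have image: "H ` quotient_space V U = h ` V"
      using bij by (simp add: bij_betw_def)
    have "y \<in> H ` quotient_space V U" if y: "y \<in> complex_vector.span (H ` B)" for y
    proof -
      from y obtain F c where F: "finite F" "F \<subseteq> B" and "y = (\<Sum>Q\<in>F. c Q *\<^sub>C H Q)"
        unfolding span by blast
      then have "y = H (quotient_lincomb U c F)" by (simp add: lin(2))
      then show ?thesis using lin(1)[OF F] by (rule image_eqI)
    qed
    then have "complex_vector.span (H ` B) \<subseteq> h ` V"
      unfolding image by (rule subsetI)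
    then have "complex_vector.span (H ` B) = h ` V \<longleftrightarrow> h ` V \<subseteq> complex_vector.span (H ` B)"
      by (simp only: set_eq_subset simp_thms)
    also have "\<dots> \<longleftrightarrow>
        (\<forall>P\<in>quotient_space V U. H P \<in> complex_vector.span (H ` B))"
      unfolding image[symmetric] by (rule image_subset_iff)
    finally have spans: "complex_vector.span (H ` B) = h ` V \<longleftrightarrow>
        (\<forall>P\<in>quotient_space V U. H P \<in> complex_vector.span (H ` B))" .
    have "(\<exists>F c. finite F \<and> F \<subseteq> B \<and> P = quotient_lincomb U c F) \<longleftrightarrow>
        H P \<in> complex_vector.span (H ` B)" if P: "P \<in> quotient_space V U" for P
    proof -
      have "P = quotient_lincomb U c F \<longleftrightarrow> H P = (\<Sum>Q\<in>F. c Q *\<^sub>C H Q)"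
        if "finite F" "F \<subseteq> B" for F c
        using eqI[OF P lin(1)[OF that]] unfolding lin(2)[OF that] .
      then have "finite F \<and> F \<subseteq> B \<and> P = quotient_lincomb U c F \<longleftrightarrow>
          H P = (\<Sum>Q\<in>F. c Q *\<^sub>C H Q) \<and> finite F \<and> F \<subseteq> B" for F c
        by metis
      then show ?thesis
        unfolding span mem_Collect_eq by (simp only:)
    qed
    then show ?thesis
      unfolding spans by (intro ball_cong refl)
  qed
  show ?thesis
    using B unfolding quotient_basis_def H_def[symmetric] independent spanning
    by (simp only: simp_thms)
qed

text \<open>The basis chosen in the definition of \<open>quotient_dim\<close> is arbitrary. Its image is a basis of
  \<open>h V\<close>, hence equipotent to \<open>C\<close>.\<close>

lemma quotient_dim_eq_card_image_basis:
  assumes h: "clinear_on V h" and U: "U = {x \<in> V. h x = 0}"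
    and C: "complex_vector.independent C" "complex_vector.span C = h ` V"
  shows "quotient_dim V U =o |C|"
proof -
  define H where "H = (\<lambda>Q. the_elem (h ` Q))"
  have bij: "bij_betw H (quotient_space V U) (h ` V)"
    unfolding H_def by (rule coset_map_bij_betw(1)[OF h U])
  note basis_iff = quotient_basis_iff_image_basis[OF h U, folded H_def]
  \<comment> \<open>Pulling \<open>C\<close> back along the isomorphism shows that the quotient has a basis at all, without
    which \<open>SOME\<close> would say nothing.\<close>
  have "C \<subseteq> H ` quotient_space V U"
    using bij C(2) complex_vector.span_superset[of C] by (simp add: bij_betw_def)
  then obtain B\<^sub>0 where "B\<^sub>0 \<subseteq> quotient_space V U" "H ` B\<^sub>0 = C"
    unfolding subset_image_iff by blast
  then have "quotient_basis V U B\<^sub>0"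
    using basis_iff C by simp
  then have B: "quotient_basis V U (SOME B. quotient_basis V U B)" (is "quotient_basis V U ?B")
    by (rule someI)
  then have sub: "?B \<subseteq> quotient_space V U"
    by (simp add: quotient_basis_def)
  have "\<exists>f. bij_betw f (H ` ?B) C"
    using B basis_iff[OF sub] by (intro complex_vector.bij_if_span_eq_span_bases C(1)) (simp_all add: C(2))
  then obtain f where "bij_betw f (H ` ?B) C"
    by (rule exE)
  moreover have "bij_betw H ?B (H ` ?B)"
    by (rule bij_betw_subset[OF bij sub refl])
  ultimately have "bij_betw (f \<circ> H) ?B C"
    by (intro bij_betw_trans)
  then show ?thesis
    unfolding quotient_dim_def by (rule card_of_ordIsoI)
qed

lemma quotient_dim_cong:
  assumes g: "clinear_on V g" and h: "clinear_on W h"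
    and U: "U = {x \<in> V. g x = 0}" and T: "T = {x \<in> W. h x = 0}"
    and eq: "g ` V = h ` W"
  shows "quotient_dim V U =o quotient_dim W T"
proof -
  obtain C where C: "C \<subseteq> g ` V" "complex_vector.independent C" "g ` V \<subseteq> complex_vector.span C"
    using complex_vector.maximal_independent_subset by blast
  then have "complex_vector.span C = g ` V"
    using clinear_on_image_subspace[OF g] by (metis complex_vector.span_minimal subset_antisym)
  then show ?thesis
    using quotient_dim_eq_card_image_basis[OF g U C(2)]
      quotient_dim_eq_card_image_basis[OF h T C(2)] eq
    by (metis ordIso_symmetric ordIso_transitive)
qed

text \<open>Every subspace has an algebraic complement: \<open>h\<close> is \<open>x - g x\<close> for a linear projection \<open>g\<close> onto
  \<open>U\<close>.\<close>

lemma subspace_is_kernel: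
  assumes "complex_vector.subspace (U :: 'a::complex_vector set)"
  shows "\<exists>h :: 'a \<Rightarrow> 'a. clinear_on UNIV h \<and> (\<forall>x. h x = 0 \<longleftrightarrow> x \<in> U)"
proof -
  interpret vector_space_pair "scaleC :: complex \<Rightarrow> 'a \<Rightarrow> 'a" "scaleC :: complex \<Rightarrow> 'a \<Rightarrow> 'a" ..
  obtain g :: "'a \<Rightarrow> 'a" where g: "range g \<subseteq> U" "Vector_Spaces.linear scaleC scaleC g"
      "\<forall>v\<in>U. g v = v"
    using linear_exists_left_inverse_on[OF complex_vector.linear_id assms inj_on_id]
    unfolding id_apply by blast
  interpret g: Vector_Spaces.linear scaleC scaleC g by (rule g(2))
  have "clinear_on UNIV (\<lambda>x. x - g x)"
    by (simp add: clinear_on_def g.add g.scale complex_vector.scale_right_diff_distrib)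
  moreover have "x - g x = 0 \<longleftrightarrow> x \<in> U" for x
  proof
    assume "x - g x = 0"
    then have "x = g x" by simp
    then show "x \<in> U" using g(1) by (metis rangeI subsetD)
  qed (simp add: g(3))
  ultimately show ?thesis by blast
qed

text \<open>The isomorphism \<open>V / U \<cong> Q V / Q U\<close> induced by a linear map whose kernel on \<open>V\<close> lies in \<open>U\<close>.
  If \<open>h\<close> has kernel \<open>Q U\<close>, then \<open>h \<circ> Q\<close> has kernel \<open>U\<close> on \<open>V\<close>, and both quotients are
  isomorphic to \<open>h (Q V)\<close>.\<close>

lemma quotient_dim_image:
  fixes Q :: "'a::complex_vector \<Rightarrow> 'b::complex_vector"
  assumes Q: "clinear_on V Q" and U: "complex_vector.subspace U" "U \<subseteq> V"
    and ker: "\<And>x. x \<in> V \<Longrightarrow> Q x = 0 \<Longrightarrow> x \<in> U"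
  shows "quotient_dim V U =o quotient_dim (Q ` V) (Q ` U)"
proof -
  note V = clinear_on_subspace[OF Q]
  have QU: "complex_vector.subspace (Q ` U)"
    by (rule clinear_on_image_subspace[OF clinear_on_mono[OF Q U]])
  obtain h :: "'b \<Rightarrow> 'b" where h: "clinear_on UNIV h" "\<And>y. h y = 0 \<longleftrightarrow> y \<in> Q ` U"
    using subspace_is_kernel[OF QU] by auto
  have "x \<in> U" if "x \<in> V" "Q x \<in> Q ` U" for x
  proof -
    from that obtain u where u: "u \<in> U" "Q x = Q u" by blast
    then have "x - u \<in> U"
      using that U V by (intro ker)
        (auto simp: clinear_on_diff[OF Q] complex_vector.subspace_diff)
    then show "x \<in> U"
      using complex_vector.subspace_add[OF U(1) _ u(1)] by force
  qed
  then have "U = {x \<in> V. h (Q x) = 0}"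
    using U(2) h(2) by auto
  moreover have "Q ` U = {y \<in> Q ` V. h y = 0}"
    using U(2) h(2) by auto
  moreover have "clinear_on V (\<lambda>x. h (Q x))"
    using V by (simp add: clinear_on_def[of V] clinear_on_add[OF Q] clinear_on_scale[OF Q]
        clinear_on_add[OF h(1)] clinear_on_scale[OF h(1)])
  moreover have "clinear_on (Q ` V) h"
    using clinear_on_mono[OF h(1) clinear_on_image_subspace[OF Q]] by simp
  ultimately show ?thesis
    by (intro quotient_dim_cong[where g = "\<lambda>x. h (Q x)" and h = h]) (auto simp: image_image)
qed

section \<open>Chains of a pair of operators\<close>

lemma bij_betw_UNIV_E:
  assumes "bij_betw f D UNIV"
  obtains x where "x \<in> D" "f x = y"
proof -
  have "y \<in> f ` D"
    unfolding bij_betw_imp_surj_on[OF assms] by (rule UNIV_I)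
  then show ?thesis using that by blast
qed

text \<open>The ends \<open>x\<^sub>n\<close> of chains \<open>P x\<^sub>j = Q x\<^sub>j\<^sub>-\<^sub>1\<close>, \<open>x\<^sub>0 = 0\<close>, in \<open>D\<close>. The order of the arguments is
  that of \<open>kernel_rep\<close>.\<close>

definition chain_kernel ::
    "('a::complex_vector \<Rightarrow> 'b::complex_vector) \<Rightarrow> 'a set \<Rightarrow> ('a \<Rightarrow> 'b) \<Rightarrow> nat \<Rightarrow> 'a set"
  where "chain_kernel Q D P n = relation_ker (relation_power D (kernel_rep Q D P) n)"

lemma chain_kernel_0: "0 \<in> D \<Longrightarrow> chain_kernel Q D P 0 = {0}"
  by (auto simp: chain_kernel_def relation_ker_def)

lemma chain_kernel_subset: "chain_kernel Q D P n \<subseteq> D"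
  by (cases n) (auto simp: chain_kernel_def relation_ker_def kernel_rep_def)

lemma chain_kernel_Suc:
  "chain_kernel Q D P (Suc n) = {x \<in> D. \<exists>x'\<in>chain_kernel Q D P n. P x = Q x'}"
  using chain_kernel_subset[of Q D P n]
  by (auto simp: chain_kernel_def relation_ker_def kernel_rep_def)

lemma chain_kernel_subspace:
  assumes P: "clinear_on D P" and Q: "clinear_on D Q"
  shows "complex_vector.subspace (chain_kernel Q D P n)"
proof (induction n)
  case 0
  then show ?case
    using clinear_on_subspace[OF P]
    by (simp add: chain_kernel_0 complex_vector.subspace_0 complex_vector.subspace_single_0)
next
  case (Suc n)
  let ?K = "chain_kernel Q D P n"
  note D = clinear_on_subspace[OF P] and KD = subsetD[OF chain_kernel_subset[of Q D P n]]
  show ?case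
    unfolding chain_kernel_Suc
  proof (rule complex_vector.subspaceI)
    show "0 \<in> {x \<in> D. \<exists>x'\<in>?K. P x = Q x'}"
      using D Suc clinear_on_0[OF P] clinear_on_0[OF Q]
      by (auto intro!: bexI[of _ 0] complex_vector.subspace_0)
  next
    fix x y assume "x \<in> {x \<in> D. \<exists>x'\<in>?K. P x = Q x'}" "y \<in> {x \<in> D. \<exists>x'\<in>?K. P x = Q x'}"
    then obtain x' y' where xy: "x \<in> D" "y \<in> D" "x' \<in> ?K" "y' \<in> ?K" "P x = Q x'" "P y = Q y'"
      by blast
    have "x + y \<in> D" "x' + y' \<in> ?K"
      using xy by (simp_all add: complex_vector.subspace_add[OF D] complex_vector.subspace_add[OF Suc])
    moreover have "P (x + y) = Q (x' + y')"
      using xy by (simp add: clinear_on_add[OF P] clinear_on_add[OF Q] KD)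
    ultimately show "x + y \<in> {x \<in> D. \<exists>x'\<in>?K. P x = Q x'}"
      by blast
  next
    fix c x assume "x \<in> {x \<in> D. \<exists>x'\<in>?K. P x = Q x'}"
    then obtain x' where x: "x \<in> D" "x' \<in> ?K" "P x = Q x'"
      by blast
    have "c *\<^sub>C x \<in> D" "c *\<^sub>C x' \<in> ?K"
      using x by (simp_all add: complex_vector.subspace_scale[OF D]
          complex_vector.subspace_scale[OF Suc])
    moreover have "P (c *\<^sub>C x) = Q (c *\<^sub>C x')"
      using x by (simp add: clinear_on_scale[OF P] clinear_on_scale[OF Q] KD)
    ultimately show "c *\<^sub>C x \<in> {x \<in> D. \<exists>x'\<in>?K. P x = Q x'}"
      by blast
  qed
qed

lemma chain_kernel_mono:
  assumes P: "clinear_on D P" and Q: "clinear_on D Q"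
  shows "chain_kernel Q D P n \<subseteq> chain_kernel Q D P (Suc n)"
proof (induction n)
  case 0
  have "0 \<in> D" by (rule complex_vector.subspace_0[OF clinear_on_subspace[OF P]])
  then show ?case
    using complex_vector.subspace_0[OF chain_kernel_subspace[OF P Q, of "Suc 0"]]
    by (simp add: chain_kernel_0)
next
  case (Suc n)
  then show ?case
    unfolding chain_kernel_Suc[of _ _ _ n] chain_kernel_Suc[of _ _ _ "Suc n"] by blast
qed

text \<open>A step of the range representation goes from \<open>Q y\<close> to \<open>P y\<close>. That \<open>P y\<close> is again of the form
  \<open>Q x'\<close> with \<open>x'\<close> the end of a chain is exactly the condition for \<open>y\<close> to prolong that chain.\<close>

lemma range_chain_kernel:
  assumes "clinear_on D P" "clinear_on D Q"
  shows "relation_ker (relation_power UNIV (range_rep Q D P) n) = Q ` chain_kernel Q D P n"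
proof (induction n)
  case 0
  have "0 \<in> D" by (rule complex_vector.subspace_0[OF clinear_on_subspace[OF assms(1)]])
  then show ?case
    using clinear_on_0[OF assms(2)] by (auto simp: chain_kernel_0 relation_ker_def)
next
  case (Suc n)
  have "relation_ker (relation_power UNIV (range_rep Q D P) (Suc n)) =
      Q ` {y \<in> D. P y \<in> relation_ker (relation_power UNIV (range_rep Q D P) n)}"
    by (auto simp: relation_ker_def range_rep_def)
  also have "\<dots> = Q ` chain_kernel Q D P (Suc n)"
    unfolding Suc chain_kernel_Suc by auto
  finally show ?case .
qed

section \<open>Regular pairs of operators\<close>

text \<open>With \<open>W = aP + bQ\<close>, the vector \<open>y\<close> is \<open>W\<^sup>-\<^sup>1Q x\<close>. If \<open>x'\<close> precedes \<open>x\<close> in a chain, then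
  \<open>y' = W\<^sup>-\<^sup>1Q x'\<close> precedes \<open>y\<close>, since \<open>W\<^sup>-\<^sup>1Q\<close> commutes with \<open>W\<^sup>-\<^sup>1P\<close>. The commutation is used in
  elementary form: as \<open>Q x' = P x\<close>, also \<open>y' = W\<^sup>-\<^sup>1P x\<close>, whence \<open>a y' + b y = x\<close>; applying \<open>P\<close> and
  \<open>Q\<close> to this identity gives \<open>b P y = b Q y'\<close> and \<open>a P y = a Q y'\<close>.\<close>

lemma chain_kernel_resolvent_invariant:
  assumes P: "clinear_on D P" and Q: "clinear_on D Q"
    and bij: "bij_betw (\<lambda>x. a *\<^sub>C P x + b *\<^sub>C Q x) D UNIV" and ab: "a \<noteq> 0 \<or> b \<noteq> 0"
  shows "x \<in> chain_kernel Q D P n \<Longrightarrow> y \<in> D \<Longrightarrow> a *\<^sub>C P y + b *\<^sub>C Q y = Q x \<Longrightarrow>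
    y \<in> chain_kernel Q D P n"
proof (induction n arbitrary: x y)
  case 0
  have D0: "0 \<in> D" by (rule complex_vector.subspace_0[OF clinear_on_subspace[OF P]])
  then have "x = 0" using 0(1) by (simp add: chain_kernel_0)
  then have "a *\<^sub>C P y + b *\<^sub>C Q y = a *\<^sub>C P 0 + b *\<^sub>C Q 0"
    using 0(3) by (simp add: clinear_on_0[OF P] clinear_on_0[OF Q])
  then have "y = 0"
    by (rule inj_onD[OF bij_betw_imp_inj_on[OF bij] _ 0(2) D0])
  then show ?case
    using D0 by (simp add: chain_kernel_0)
next
  case (Suc n)
  note D = clinear_on_subspace[OF P]
  obtain x' where x: "x \<in> D" and x': "x' \<in> chain_kernel Q D P n" and Px: "P x = Q x'"
    using Suc.prems(1) unfolding chain_kernel_Suc by blast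
  obtain y' where y': "y' \<in> D" and Wy': "a *\<^sub>C P y' + b *\<^sub>C Q y' = Q x'"
    by (rule bij_betw_UNIV_E[OF bij])
  have "y' \<in> chain_kernel Q D P n"
    by (rule Suc.IH[OF x' y' Wy'])
  moreover have "P y = Q y'"
  proof -
    let ?z = "a *\<^sub>C y' + b *\<^sub>C y"
    have z: "?z \<in> D"
      using D y' Suc.prems(2)
      by (simp add: complex_vector.subspace_add complex_vector.subspace_scale)
    have Pz: "P ?z = a *\<^sub>C P y' + b *\<^sub>C P y" and Qz: "Q ?z = a *\<^sub>C Q y' + b *\<^sub>C Q y"
      using D y' Suc.prems(2)
      by (simp_all add: complex_vector.subspace_scale clinear_on_add[OF P] clinear_on_add[OF Q]
          clinear_on_scale[OF P] clinear_on_scale[OF Q])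
    have "a *\<^sub>C P ?z + b *\<^sub>C Q ?z =
        a *\<^sub>C (a *\<^sub>C P y' + b *\<^sub>C Q y') + b *\<^sub>C (a *\<^sub>C P y + b *\<^sub>C Q y)"
      by (simp add: Pz Qz scaleC_add_right scaleC_scaleC algebra_simps)
    also have "\<dots> = a *\<^sub>C P x + b *\<^sub>C Q x"
      by (simp add: Wy' Suc.prems(3) Px)
    finally have zx: "?z = x"
      by (rule inj_onD[OF bij_betw_imp_inj_on[OF bij] _ z x])
    have "a *\<^sub>C P y' + b *\<^sub>C P y = P x"
      using Pz unfolding zx by (rule sym)
    also have "\<dots> = a *\<^sub>C P y' + b *\<^sub>C Q y'"
      unfolding Px Wy' by (rule refl)
    finally have "b *\<^sub>C P y = b *\<^sub>C Q y'" by (rule add_left_imp_eq)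
    moreover have "a *\<^sub>C Q y' + b *\<^sub>C Q y = a *\<^sub>C P y + b *\<^sub>C Q y"
      using Qz unfolding zx Suc.prems(3) by (rule sym)
    then have "a *\<^sub>C Q y' = a *\<^sub>C P y" by (rule add_right_imp_eq)
    ultimately show ?thesis using ab by auto
  qed
  ultimately show ?case
    using Suc.prems(2) unfolding chain_kernel_Suc by blast
qed

text \<open>The injectivity of the map that \<open>Q\<close> induces on quotients: \<open>W x = a P x = a Q x'\<close> exhibits \<open>x\<close> as
  \<open>a W\<^sup>-\<^sup>1Q x'\<close> with \<open>x'\<close> one step shorter.\<close>

lemma chain_kernel_inter_kernel:
  assumes P: "clinear_on D P" and Q: "clinear_on D Q"
    and bij: "bij_betw (\<lambda>x. a *\<^sub>C P x + b *\<^sub>C Q x) D UNIV" and ab: "a \<noteq> 0 \<or> b \<noteq> 0"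
    and x: "x \<in> chain_kernel Q D P (Suc n)" and Qx: "Q x = 0"
  shows "x \<in> chain_kernel Q D P n"
proof -
  note D = clinear_on_subspace[OF P]
  obtain x' where xD: "x \<in> D" and x': "x' \<in> chain_kernel Q D P n" and Px: "P x = Q x'"
    using x unfolding chain_kernel_Suc by blast
  obtain y where y: "y \<in> D" and Wy: "a *\<^sub>C P y + b *\<^sub>C Q y = Q x'"
    by (rule bij_betw_UNIV_E[OF bij])
  have "y \<in> chain_kernel Q D P n"
    by (rule chain_kernel_resolvent_invariant[OF P Q bij ab x' y Wy])
  then have "a *\<^sub>C y \<in> chain_kernel Q D P n"
    by (rule complex_vector.subspace_scale[OF chain_kernel_subspace[OF P Q]])
  moreover have "a *\<^sub>C y = x"
  proof -
    have "a *\<^sub>C P (a *\<^sub>C y) + b *\<^sub>C Q (a *\<^sub>C y) = a *\<^sub>C (a *\<^sub>C P y + b *\<^sub>C Q y)"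
      using y by (simp add: clinear_on_scale[OF P] clinear_on_scale[OF Q] scaleC_add_right
          scaleC_scaleC mult.commute)
    also have "\<dots> = a *\<^sub>C P x + b *\<^sub>C Q x"
      by (simp add: Wy Px Qx)
    finally show ?thesis
      by (rule inj_onD[OF bij_betw_imp_inj_on[OF bij] _ complex_vector.subspace_scale[OF D y] xD])
  qed
  ultimately show ?thesis by simp
qed

lemma quotient_dim_chain_kernel:
  assumes P: "clinear_on D P" and Q: "clinear_on D Q"
    and bij: "bij_betw (\<lambda>x. a *\<^sub>C P x + b *\<^sub>C Q x) D UNIV" and ab: "a \<noteq> 0 \<or> b \<noteq> 0"
  shows "quotient_dim (chain_kernel Q D P (Suc n)) (chain_kernel Q D P n) =o
    quotient_dim (relation_ker (relation_power UNIV (range_rep Q D P) (Suc n)))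
      (relation_ker (relation_power UNIV (range_rep Q D P) n))"
  unfolding range_chain_kernel[OF P Q]
  by (intro quotient_dim_image clinear_on_mono[OF Q] chain_kernel_subspace[OF P Q]
      chain_kernel_subset chain_kernel_mono[OF P Q])
    (rule chain_kernel_inter_kernel[OF P Q bij ab])

section \<open>Weyr characteristics of the two representations\<close>

text \<open>Shift and converse lead from a representation of the pair \<open>(E, A)\<close> to the same
  representation of \<open>(E, A - \<zeta>E)\<close> and \<open>(A, E)\<close>, so root subspaces at any \<open>\<zeta>\<close> are chain kernels.\<close>

lemma relation_shift_kernel_rep:
  assumes E: "clinear_on D E"
  shows "relation_shift (kernel_rep E D A) \<zeta> = kernel_rep E D (\<lambda>x. A x - \<zeta> *\<^sub>C E x)"
proof (intro subset_antisym subrelI)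
  note D = clinear_on_subspace[OF E]
  fix x z
  show "(x, z) \<in> kernel_rep E D (\<lambda>x. A x - \<zeta> *\<^sub>C E x)"
    if "(x, z) \<in> relation_shift (kernel_rep E D A) \<zeta>"
    using that D by (auto simp: relation_shift_def kernel_rep_def clinear_on_diff[OF E]
        clinear_on_scale[OF E] complex_vector.subspace_diff complex_vector.subspace_scale)
  assume xz: "(x, z) \<in> kernel_rep E D (\<lambda>x. A x - \<zeta> *\<^sub>C E x)"
  then have "(x, z + \<zeta> *\<^sub>C x) \<in> kernel_rep E D A"
    using D by (auto simp: kernel_rep_def clinear_on_add[OF E] clinear_on_scale[OF E]
        complex_vector.subspace_add complex_vector.subspace_scale algebra_simps)
  then show "(x, z) \<in> relation_shift (kernel_rep E D A) \<zeta>"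
    unfolding relation_shift_def by force
qed

lemma relation_shift_range_rep:
  "relation_shift (range_rep E D A) \<zeta> = range_rep E D (\<lambda>x. A x - \<zeta> *\<^sub>C E x)"
  by (auto simp: relation_shift_def range_rep_def)

lemma converse_kernel_rep: "(kernel_rep E D A)\<inverse> = kernel_rep A D E"
  by (auto simp: kernel_rep_def)

lemma converse_range_rep: "(range_rep E D A)\<inverse> = range_rep A D E"
  by (auto simp: range_rep_def)

lemma weyr_kernel_rep_range_rep:
  assumes E: "clinear_on D E" and A: "clinear_on D A"
    and bij: "bij_betw (\<lambda>x. \<mu> *\<^sub>C E x - A x) D UNIV"
  shows "weyr D (kernel_rep E D A) (Suc n) \<zeta> =o weyr UNIV (range_rep E D A) (Suc n) \<zeta>"
proof (cases \<zeta>)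
  case (Fin \<nu>)
  let ?P = "\<lambda>x. A x - \<nu> *\<^sub>C E x"
  have P: "clinear_on D ?P"
    using E A by (simp add: clinear_on_def complex_vector.scale_right_diff_distrib
        scaleC_add_right scaleC_scaleC mult.commute)
  \<comment> \<open>\<open>\<mu>E - A = -(A - \<nu>E) + (\<mu> - \<nu>)E\<close>\<close>
  have "(\<lambda>x. (-1) *\<^sub>C ?P x + (\<mu> - \<nu>) *\<^sub>C E x) = (\<lambda>x. \<mu> *\<^sub>C E x - A x)"
    by (simp add: complex_vector.scale_left_diff_distrib)
  then show ?thesis
    using quotient_dim_chain_kernel[OF P E, of "-1" "\<mu> - \<nu>" n] bij
    by (simp add: Fin weyr_def chain_kernel_def relation_shift_kernel_rep[OF E] relation_shift_range_rep
        del: relation_power.simps)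
next
  case Infty
  have "(\<lambda>x. \<mu> *\<^sub>C E x + (-1) *\<^sub>C A x) = (\<lambda>x. \<mu> *\<^sub>C E x - A x)"
    by simp
  then show ?thesis
    using quotient_dim_chain_kernel[OF E A, of \<mu> "-1" n] bij
    by (simp add: Infty weyr_def chain_kernel_def converse_kernel_rep converse_range_rep
        del: relation_power.simps)
qed

theorem theorem4p5:
  fixes E A :: "'x::complex_banach \<Rightarrow> 'y::complex_banach"
    and D :: "'x set"
  assumes "bounded_clinear E"
    and "clinear_on D A"
    and "closed_operator_on D A"
    and "densely_defined D"
    and "\<exists>\<mu>::complex. bij_betw (\<lambda>x. \<mu> *\<^sub>C E x - A x) D UNIV"
  shows "\<forall>\<zeta>::ext_complex. \<forall>k::nat. k \<ge> 1 \<longrightarrow>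
    weyr D (kernel_rep E D A) k \<zeta> =o pencil_weyr E D A k \<zeta> \<and>
    pencil_weyr E D A k \<zeta> =o weyr UNIV (range_rep E D A) k \<zeta>"
proof (intro allI impI conjI)
  fix \<zeta> and k :: nat
  assume "k \<ge> 1"
  then obtain n where k: "k = Suc n" by (cases k) auto
  show "weyr D (kernel_rep E D A) k \<zeta> =o pencil_weyr E D A k \<zeta>"
    by (simp add: pencil_weyr_def weyr_def quotient_dim_def card_of_refl)
  interpret E: Vector_Spaces.linear scaleC scaleC E
    using assms(1) by (simp add: bounded_clinear_def)
  have E: "clinear_on D E"
    using clinear_on_subspace[OF assms(2)] by (simp add: clinear_on_def E.add E.scale)
  obtain \<mu> where "bij_betw (\<lambda>x. \<mu> *\<^sub>C E x - A x) D UNIV"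
    using assms(5) by blast
  then show "pencil_weyr E D A k \<zeta> =o weyr UNIV (range_rep E D A) k \<zeta>"
    unfolding pencil_weyr_def k by (rule weyr_kernel_rep_range_rep[OF E assms(2)])
qed

end
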